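(* Let $\Gamma$ be a finitely generated profinite group with positive rank gradient, let $n\in\mathbb{N}$, and let $H_1,\dots,H_n$ be finitely generated closed subgroups of infinite index in $\Gamma$. Then $\mu_\Gamma(H_1\cdots H_n)=0$, where $\mu_\Gamma$ is the normalized Haar measure on $\Gamma$ and $H_1\cdots H_n=\{h_1\cdots h_n: h_i\in H_i\}$.
   Context: For profinite groups, only closed subgroups are considered, and generation is topological: $d(U)$ is the minimal cardinality of a subset generating a dense subgroup of $U$, and "finitely generated" means $d<\infty$. The rank gradient of a finitely generated profinite group $\Gamma$ is $\nabla\Gamma=\inf_U\frac{d(U)-1}{[\Gamma:U]}$, where $U$ ranges over the open subgroups of $\Gamma$. *)

theory Defs
  imports "HOL-Analysis.Analysis" "HOL-Probability.Probability" "HOL-Algebra.Algebra"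
begin

definition topological_group :: "('a, 'b) monoid_scheme \<Rightarrow> 'a topology \<Rightarrow> bool" where
  "topological_group G T \<longleftrightarrow> group G \<and> topspace T = carrier G
     \<and> continuous_map (prod_topology T T) T (\<lambda>(x, y). x \<otimes>\<^bsub>G\<^esub> y)
     \<and> continuous_map T T (\<lambda>x. inv\<^bsub>G\<^esub> x)"

definition totally_disconnected_space :: "'a topology \<Rightarrow> bool" where
  "totally_disconnected_space T \<longleftrightarrow>
     (\<forall>S. connectedin T S \<longrightarrow> (\<forall>x\<in>S. \<forall>y\<in>S. x = y))"

definition profinite_group :: "('a, 'b) monoid_scheme \<Rightarrow> 'a topology \<Rightarrow> bool" where
  "profinite_group G T \<longleftrightarrow> topological_group G T \<and> compact_space T
     \<and> Hausdorff_space T \<and> totally_disconnected_space T"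

definition closed_subgroup :: "('a, 'b) monoid_scheme \<Rightarrow> 'a topology \<Rightarrow> 'a set \<Rightarrow> bool" where
  "closed_subgroup G T H \<longleftrightarrow> subgroup H G \<and> closedin T H"

definition open_subgroup :: "('a, 'b) monoid_scheme \<Rightarrow> 'a topology \<Rightarrow> 'a set \<Rightarrow> bool" where
  "open_subgroup G T H \<longleftrightarrow> subgroup H G \<and> openin T H"

definition top_generates :: "('a, 'b) monoid_scheme \<Rightarrow> 'a topology \<Rightarrow> 'a set \<Rightarrow> 'a set \<Rightarrow> bool" where
  "top_generates G T S H \<longleftrightarrow> S \<subseteq> H \<and> H \<subseteq> T closure_of (generate G S)"

definition top_fin_gen :: "('a, 'b) monoid_scheme \<Rightarrow> 'a topology \<Rightarrow> 'a set \<Rightarrow> bool" where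
  "top_fin_gen G T H \<longleftrightarrow> (\<exists>S. finite S \<and> top_generates G T S H)"

text \<open>d(H): minimal cardinality of a (finite) topological generating set
  (only used for finitely generated H).\<close>
definition dgen :: "('a, 'b) monoid_scheme \<Rightarrow> 'a topology \<Rightarrow> 'a set \<Rightarrow> nat" where
  "dgen G T H = (LEAST k. \<exists>S. finite S \<and> card S = k \<and> top_generates G T S H)"

definition group_index :: "('a, 'b) monoid_scheme \<Rightarrow> 'a set \<Rightarrow> nat" where
  "group_index G H = card (rcosets\<^bsub>G\<^esub> H)"

definition rank_gradient :: "('a, 'b) monoid_scheme \<Rightarrow> 'a topology \<Rightarrow> real" where
  "rank_gradient G T = Inf {(real (dgen G T U) - 1) / real (group_index G U) | U. open_subgroup G T U}"

definition borel_sets_of :: "'a topology \<Rightarrow> 'a set set" where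
  "borel_sets_of T = sigma_sets (topspace T) {U. openin T U}"

definition normalized_haar :: "('a, 'b) monoid_scheme \<Rightarrow> 'a topology \<Rightarrow> 'a measure \<Rightarrow> bool" where
  "normalized_haar G T M \<longleftrightarrow>
     prob_space M \<and> space M = topspace T \<and> sets M = borel_sets_of T
     \<and> (\<forall>g\<in>carrier G. \<forall>A\<in>sets M. emeasure M ((\<lambda>y. g \<otimes>\<^bsub>G\<^esub> y) ` A) = emeasure M A)
     \<and> (\<forall>A\<in>sets M. emeasure M A = (INF U\<in>{U. openin T U \<and> A \<subseteq> U}. emeasure M U))
     \<and> (\<forall>A\<in>sets M. emeasure M A = (SUP K\<in>{K. compactin T K \<and> K \<subseteq> A}. emeasure M K))"

fun prod_sets :: "('a, 'b) monoid_scheme \<Rightarrow> 'a set list \<Rightarrow> 'a set" where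
  "prod_sets G [] = {\<one>\<^bsub>G\<^esub>}"
| "prod_sets G (A # As) = A <#>\<^bsub>G\<^esub> prod_sets G As"

end

theory Submission
  imports Defs
begin

text \<open>Call a closed subgroup thin if it is finitely generated of infinite index. For thin \<open>A\<close>, \<open>B\<close>
  choose open subgroups \<open>U\<close> containing \<open>B\<close> and \<open>V\<close> containing \<open>A\<close>, both of large index. The closed
  subgroup \<open>C\<close> generated by \<open>A \<inter> U\<close> and \<open>B \<inter> V\<close> lies in \<open>U \<inter> V\<close> and, by Schreier's bound, needs few
  generators compared with \<open>[G : U \<inter> V]\<close>; positivity of the rank gradient therefore forbids \<open>C\<close> to
  be open, so \<open>C\<close> is thin again. As \<open>A \<inter> U\<close> and \<open>B \<inter> V\<close> have finite index in \<open>A\<close> and \<open>B\<close>, the product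
  \<open>A B\<close> is covered by finitely many left cosets of conjugates of \<open>C\<close>. Inductively every finite product
  of thin subgroups is covered by finitely many cosets of thin subgroups, which are null sets. The
  empty product is included because a positive rank gradient makes the trivial subgroup thin.\<close>

section \<open>Abstract groups: cosets, Schreier generators, conjugation\<close>

context group
begin

lemma rcoset_eq_iff:
  assumes "subgroup U G" "x \<in> carrier G" "y \<in> carrier G"
  shows "U #> x = U #> y \<longleftrightarrow> x \<otimes> inv y \<in> U"
proof
  interpret U: subgroup U G by fact
  assume "U #> x = U #> y"
  then have "x \<in> U #> y"
    using rcos_self[OF assms(2,1)] by simp
  then show "x \<otimes> inv y \<in> U"
    using U.rcos_module_imp[OF is_group assms(3)] by blast
next
  interpret U: subgroup U G by fact
  assume "x \<otimes> inv y \<in> U"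
  then have "x \<in> U #> y"
    using U.rcos_module_rev[OF is_group assms(3,2)] by blast
  then show "U #> x = U #> y"
    using repr_independence[OF _ assms(3,1)] by simp
qed

lemma mult_inv_cancel_left:
  assumes "y \<in> carrier G" "z \<in> carrier G"
  shows "y \<otimes> (inv y \<otimes> z) = z" "inv y \<otimes> (y \<otimes> z) = z"
  using assms by (simp_all flip: m_assoc)

lemma rcosets_eq_image: "rcosets U = (#>) U ` carrier G"
  by (auto simp: RCOSETS_def)

text \<open>Schreier's argument for D = \<open>generate G S\<close>. The index of
  \<open>D \<inter> U\<close> in D is expressed as the number of cosets \<open>U #> x\<close> with x
  in D. One generator for each pair of a representative and an element of S gives the crude bound,
  which is strong enough for the estimate against the rank gradient.\<close>

lemma schreier_generators:
  assumes S: "S \<subseteq> carrier G" "finite S" and U: "subgroup U G"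
    and fin: "finite ((#>) U ` generate G S)"
  obtains Z where "finite Z" "Z \<subseteq> generate G S \<inter> U"
    "card Z \<le> card S * card ((#>) U ` generate G S)"
    "generate G S \<inter> U \<subseteq> generate G Z"
proof -
  interpret U: subgroup U G by fact
  define D where "D = generate G S"
  interpret D: subgroup D G
    unfolding D_def by (rule generate_is_subgroup[OF S(1)])
  \<comment> \<open>The coset U is represented by \<open>\<one>\<close>; this normalisation removes
    the factor r at the end.\<close>
  define g where "g c = (if c = U then \<one> else SOME r. r \<in> D \<and> U #> r = c)" for c
  define t where "t x = g (U #> x)" for x
  have tD: "t x \<in> D" and tU: "U #> t x = U #> x" if "x \<in> D" for x
  proof -
    have "t x \<in> D \<and> U #> t x = U #> x"
    proof (cases "U #> x = U")
      case True
      then show ?thesis by (simp add: t_def g_def U.subset)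
    next
      case False
      then show ?thesis
        unfolding t_def g_def using someI[of "\<lambda>r. r \<in> D \<and> U #> r = U #> x" x] that by simp
    qed
    then show "t x \<in> D" "U #> t x = U #> x" by auto
  qed
  have t1: "t x = \<one>" if "x \<in> U" for x
    using U.rcos_const[OF is_group that] by (simp add: t_def g_def)
  define R where "R = t ` D"
  have R_eq: "R = g ` (#>) U ` D"
    by (auto simp: R_def t_def)
  have finR: "finite R" and cardR: "card R \<le> card ((#>) U ` D)"
    using fin card_image_le[of "(#>) U ` D" g] by (auto simp: R_eq D_def)
  have RD: "R \<subseteq> D"
    using tD by (auto simp: R_def)
  have tR: "t r = r" if "r \<in> R" for r
    using that tU by (auto simp: R_def t_def)
  have SD: "S \<subseteq> D"
    unfolding D_def by (auto intro: generate.incl)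
  \<comment> \<open>The Schreier generators: each corrects a product r s to the chosen
    representative of its U-coset.\<close>
  define Z where "Z = (\<lambda>(r, s). r \<otimes> s \<otimes> inv (t (r \<otimes> s))) ` (R \<times> S)"
  have ZG: "Z \<subseteq> D \<inter> U"
  proof
    fix x assume "x \<in> Z"
    then obtain r s where rs: "r \<in> R" "s \<in> S" "x = r \<otimes> s \<otimes> inv (t (r \<otimes> s))"
      by (auto simp: Z_def)
    have "r \<otimes> s \<in> D"
      using rs RD SD by blast
    moreover have "x \<in> U"
      using rcoset_eq_iff[OF U, of "r \<otimes> s" "t (r \<otimes> s)"] tU[OF calculation] tD[OF calculation]
        calculation D.subset rs by auto
    ultimately show "x \<in> D \<inter> U"
      using tD[of "r \<otimes> s"] rs by auto
  qed
  define L where "L = generate G Z"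
  interpret L: subgroup L G
    unfolding L_def by (rule generate_is_subgroup) (use ZG U.subset in blast)
  have ZL: "Z \<subseteq> L"
    unfolding L_def by (auto intro: generate.incl)
  \<comment> \<open>The set L R contains \<open>\<one>\<close> and will turn out to be stable under
    right multiplication by D, hence contains D.\<close>
  define LR where "LR = {l \<otimes> r |l r. l \<in> L \<and> r \<in> R}"
  have LRG: "LR \<subseteq> carrier G"
    using RD D.subset L.subset by (auto simp: LR_def)
  have right: "l \<otimes> r \<otimes> s \<in> LR"
    if a: "l \<in> L" "r \<in> R" "s \<in> carrier G" "t' \<in> R" "r \<otimes> s \<otimes> inv t' \<in> L" for l r s t'
  proof -
    have [simp]: "l \<in> carrier G" "r \<in> carrier G" "s \<in> carrier G" "t' \<in> carrier G"
      using a RD D.subset L.subset by auto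
    have "l \<otimes> r \<otimes> s = (l \<otimes> (r \<otimes> s \<otimes> inv t')) \<otimes> t'"
      by (simp add: m_assoc)
    then show ?thesis
      unfolding LR_def using a by (blast intro: L.m_closed)
  qed
  have step: "y \<otimes> x \<in> LR" if "x \<in> D" "y \<in> LR" for x y
    using that unfolding D_def
  proof (induction arbitrary: y rule: generate.induct)
    case one
    then show ?case using LRG by auto
  next
    case (incl s)
    then obtain l r where y: "y = l \<otimes> r" "l \<in> L" "r \<in> R" by (auto simp: LR_def)
    have "r \<otimes> s \<in> D" using y incl RD SD by blast
    then have "t (r \<otimes> s) \<in> R" by (simp add: R_def)
    moreover have "r \<otimes> s \<otimes> inv (t (r \<otimes> s)) \<in> L"
      using ZL y incl by (auto simp: Z_def)
    ultimately show ?case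
      using right[OF y(2,3)] y(1) incl S(1) by auto
  next
    case (inv s)
    then obtain l r where y: "y = l \<otimes> r" "l \<in> L" "r \<in> R" by (auto simp: LR_def)
    have s: "s \<in> D" "s \<in> carrier G" and r: "r \<in> D" "r \<in> carrier G"
      using inv y SD S RD D.subset by auto
    have rs: "r \<otimes> inv s \<in> D" using r s by blast
    \<comment> \<open>For an inverse generator, r' represents the coset of r (inv s). Then r' s lies
      in the coset of r, so r' s (inv r) is a Schreier generator, and its inverse is the correction
      needed here.\<close>
    define r' where "r' = t (r \<otimes> inv s)"
    have r': "r' \<in> R" "r' \<in> D" "r' \<in> carrier G"
      using rs tD D.subset by (auto simp: r'_def R_def)
    have "r' \<otimes> inv (r \<otimes> inv s) \<in> U"
      using rcoset_eq_iff[OF U, of r' "r \<otimes> inv s"] tU[OF rs] r r' s by (simp add: r'_def)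
    then have "U #> (r' \<otimes> s) = U #> r"
      using rcoset_eq_iff[OF U, of "r' \<otimes> s" r] r r' s by (simp add: inv_mult_group m_assoc)
    then have "t (r' \<otimes> s) = r"
      using tR[OF y(3)] by (simp add: t_def)
    then have "r' \<otimes> s \<otimes> inv r \<in> L"
      using ZL r' inv by (force simp: Z_def)
    then have "inv (r' \<otimes> s \<otimes> inv r) \<in> L" by blast
    moreover have "inv (r' \<otimes> s \<otimes> inv r) = r \<otimes> inv s \<otimes> inv r'"
      using r r' s by (simp add: inv_mult_group m_assoc)
    ultimately show ?case
      using right[OF y(2,3), of "inv s" r'] y(1) r' s by auto
  next
    case (eng h1 h2)
    have "h1 \<in> carrier G" "h2 \<in> carrier G" "y \<in> carrier G"
      using eng generate_in_carrier[OF S(1)] LRG by auto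
    then show ?case
      using eng.IH(2)[OF eng.IH(1)[OF eng.prems]] by (simp add: m_assoc)
  qed
  have "\<one> = t \<one>" using t1 by simp
  then have oneR: "\<one> \<in> R" by (auto simp: R_def)
  then have "\<one> \<otimes> \<one> \<in> LR" unfolding LR_def using L.one_closed by blast
  then have oneLR: "\<one> \<in> LR" by simp
  \<comment> \<open>Write x = l r. Since L lies in U, so does r, and the representative of the coset
    U is \<open>\<one>\<close>.\<close>
  have "D \<inter> U \<subseteq> L"
  proof
    fix x assume x: "x \<in> D \<inter> U"
    have "x \<in> LR" using step[OF _ oneLR, of x] x D.subset by auto
    then obtain l r where lr: "x = l \<otimes> r" "l \<in> L" "r \<in> R" by (auto simp: LR_def)
    have LU: "L \<subseteq> U"
      unfolding L_def using ZG generate_subgroup_incl[OF _ U] by blast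
    have c: "l \<in> carrier G" "r \<in> carrier G"
      using lr RD D.subset L.subset by auto
    have "inv l \<otimes> x \<in> U" using lr LU x by blast
    then have "r \<in> U" using c lr(1) by (simp add: mult_inv_cancel_left)
    then have "r = \<one>" using t1 tR lr by metis
    then show "x \<in> L" using lr c by simp
  qed
  moreover have "card Z \<le> card S * card ((#>) U ` D)"
  proof -
    have "card Z \<le> card (R \<times> S)"
      unfolding Z_def using finR S by (intro card_image_le) auto
    also have "\<dots> \<le> card S * card ((#>) U ` D)"
      using cardR by (simp add: card_cartesian_product mult.commute)
    finally show ?thesis .
  qed
  moreover have "finite Z" using finR S by (simp add: Z_def)
  ultimately show ?thesis
    using that[of Z] ZG by (simp add: D_def L_def)
qed

text \<open>For a subgroup A this is [A : A \<inter> U] [G : V] \<le> [G : U \<inter> V]. Let x run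
  through representatives in A of the U-cosets meeting A, and y through representatives of the
  V-cosets: the products x y lie in distinct cosets of U \<inter> V.\<close>

lemma card_rcosets_Int_ge:
  assumes U: "subgroup U G" and V: "subgroup V G" and AV: "A \<subseteq> V"
    and fin: "finite (rcosets (U \<inter> V))"
  shows "card ((#>) U ` A) * card (rcosets V) \<le> card (rcosets (U \<inter> V))"
proof -
  interpret U: subgroup U G by fact
  interpret V: subgroup V G by fact
  have UV: "subgroup (U \<inter> V) G"
    by (rule subgroups_Inter_pair[OF U V])
  obtain Z where Z: "Z \<subseteq> A" "inj_on ((#>) U) Z" "(#>) U ` A = (#>) U ` Z"
    using subset_image_inj[of "(#>) U ` A" "(#>) U" A] by auto
  obtain Y where Y: "Y \<subseteq> carrier G" "inj_on ((#>) V) Y" "rcosets V = (#>) V ` Y"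
    using subset_image_inj[of "rcosets V" "(#>) V" "carrier G"] rcosets_eq_image[of V] by auto
  let ?f = "\<lambda>(x, y). (U \<inter> V) #> (x \<otimes> y)"
  have ZV: "Z \<subseteq> V" "Z \<subseteq> carrier G"
    using Z AV V.subset by auto
  have "inj_on ?f (Z \<times> Y)"
  proof (rule inj_onI, clarsimp)
    fix x y x' y'
    assume a: "x \<in> Z" "y \<in> Y" "x' \<in> Z" "y' \<in> Y"
      "(U \<inter> V) #> (x \<otimes> y) = (U \<inter> V) #> (x' \<otimes> y')"
    have c: "x \<in> carrier G" "x' \<in> carrier G" "y \<in> carrier G" "y' \<in> carrier G" "x \<in> V" "x' \<in> V"
      using a ZV Y by auto
    have e: "x \<otimes> y \<otimes> inv (x' \<otimes> y') \<in> U \<inter> V"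
      using a(5) rcoset_eq_iff[OF UV, of "x \<otimes> y" "x' \<otimes> y'"] c by simp
    \<comment> \<open>Both x and x' lie in V, so cancelling them recovers y modulo V; once y = y',
      what remains determines x modulo U.\<close>
    have "inv x \<otimes> (x \<otimes> y \<otimes> inv (x' \<otimes> y')) \<otimes> x' \<in> V"
      using e c by blast
    moreover have "inv x \<otimes> (x \<otimes> y \<otimes> inv (x' \<otimes> y')) \<otimes> x' = y \<otimes> inv y'"
      using c by (simp add: m_assoc inv_mult_group mult_inv_cancel_left)
    ultimately have "V #> y = V #> y'"
      using rcoset_eq_iff[OF V] c by simp
    then have yy: "y = y'" using Y a by (auto dest: inj_onD)
    have "x \<otimes> y \<otimes> inv (x' \<otimes> y') = x \<otimes> inv x'"
      using c yy by (simp add: m_assoc inv_mult_group mult_inv_cancel_left)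
    then have "U #> x = U #> x'"
      using e rcoset_eq_iff[OF U] c by simp
    then show "x = x' \<and> y = y'" using Z a yy by (auto dest: inj_onD)
  qed
  moreover have "?f ` (Z \<times> Y) \<subseteq> rcosets (U \<inter> V)"
    using ZV Y U.subset by (auto intro!: rcosetsI)
  ultimately have "card (Z \<times> Y) \<le> card (rcosets (U \<inter> V))"
    by (metis card_inj_on_le fin)
  then show ?thesis
    using Z Y by (simp add: card_image card_cartesian_product)
qed

text \<open>The map sends \<open>C #> x\<close> to \<open>W #> x\<close>. In this form
  \<open>card_image_le\<close> yields [G : W] \<le> [G : C] when [G : C] is finite.\<close>

lemma rcosets_supergroup_eq_image:
  assumes C: "subgroup C G" and W: "subgroup W G" and "C \<subseteq> W"
  shows "rcosets W = (\<lambda>R. W <#> R) ` (rcosets C)"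
proof -
  interpret C: subgroup C G by fact
  interpret W: subgroup W G by fact
  have "w \<otimes> \<one> \<in> W <#> C" if "w \<in> W" for w
    unfolding set_mult_def using C.one_closed that by blast
  moreover have "W <#> C \<subseteq> W"
    using assms(3) by (auto simp: set_mult_def)
  ultimately have "W <#> C = W" by auto
  then have "W <#> (C #> x) = W #> x" if "x \<in> carrier G" for x
    using setmult_rcos_assoc[of W C x] that C.subset W.subset by simp
  then show ?thesis by (force simp: rcosets_eq_image)
qed

text \<open>The inverse stands on the left so that
  \<open>h \<otimes> y = y \<otimes> conj_by y h\<close> in the group: moving y to the front turns
  right cosets into left cosets of conjugates.\<close>

definition conj_by :: "'a \<Rightarrow> 'a \<Rightarrow> 'a" where
  "conj_by y h = inv y \<otimes> h \<otimes> y"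

lemma conj_by_hom:
  assumes "y \<in> carrier G"
  shows "group_hom G G (conj_by y)"
proof -
  have "conj_by y \<in> hom G G"
    using assms by (auto intro!: homI simp: conj_by_def m_assoc mult_inv_cancel_left)
  then show ?thesis by (simp add: group_hom_def group_hom_axioms_def)
qed

text \<open>Every coset K z equals y (inv y K y) (inv y z), the left translate by y of a coset of
  the conjugate, so finitely many of the latter would leave finitely many of the former.\<close>

lemma infinite_rcosets_conj_by:
  assumes "y \<in> carrier G" "K \<subseteq> carrier G" "infinite (rcosets K)"
  shows "infinite (rcosets (conj_by y ` K))"
proof
  assume fin: "finite (rcosets (conj_by y ` K))"
  have "rcosets K \<subseteq> (\<lambda>R. y <# R) ` (rcosets (conj_by y ` K))"
  proof
    fix R assume "R \<in> rcosets K"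
    then obtain z where z: "z \<in> carrier G" "R = K #> z"
      by (auto simp: rcosets_eq_image)
    have "y \<otimes> (conj_by y k \<otimes> (inv y \<otimes> z)) = k \<otimes> z" if "k \<in> K" for k
      using assms z that by (simp add: subset_iff conj_by_def m_assoc mult_inv_cancel_left)
    then have "R = y <# (conj_by y ` K #> (inv y \<otimes> z))"
      by (auto simp: z(2) r_coset_def l_coset_def)
    moreover have "conj_by y ` K #> (inv y \<otimes> z) \<in> rcosets (conj_by y ` K)"
      using assms z by (auto simp: rcosets_eq_image)
    ultimately show "R \<in> (\<lambda>R. y <# R) ` (rcosets (conj_by y ` K))" by blast
  qed
  then show False using fin assms(3) finite_surj by blast
qed

end


section \<open>Topology of a profinite group: translations, products, open and closed
  subgroups\<close>

locale profinite = group +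
  fixes T :: "'a topology"
  assumes profinite: "profinite_group G T"
begin

lemma topspace_eq [simp]: "topspace T = carrier G"
  using profinite by (simp add: profinite_group_def topological_group_def)

lemma compact: "compact_space T" and Hausdorff: "Hausdorff_space T"
  using profinite by (simp_all add: profinite_group_def)

lemma closedin_imp_compactin: "closedin T K \<Longrightarrow> compactin T K"
  using compact closedin_compact_space by blast

lemma continuous_mult: "continuous_map (prod_topology T T) T (\<lambda>(x, y). x \<otimes> y)"
  using profinite by (simp add: profinite_group_def topological_group_def)

lemma continuous_inv: "continuous_map T T (\<lambda>x. inv x)"
  using profinite by (simp add: profinite_group_def topological_group_def)

lemma continuous_mult_left:
  assumes "g \<in> carrier G" shows "continuous_map T T (\<lambda>x. g \<otimes> x)"
proof -
  have "continuous_map T (prod_topology T T) (\<lambda>x. (g, x))"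
    using assms by (simp add: continuous_map_pairwise o_def)
  from continuous_map_compose[OF this continuous_mult] show ?thesis
    by (simp add: o_def)
qed

lemma continuous_mult_right:
  assumes "g \<in> carrier G" shows "continuous_map T T (\<lambda>x. x \<otimes> g)"
proof -
  have "continuous_map T (prod_topology T T) (\<lambda>x. (x, g))"
    using assms by (simp add: continuous_map_pairwise o_def)
  from continuous_map_compose[OF this continuous_mult] show ?thesis
    by (simp add: o_def)
qed

lemma homeomorphic_mult_left:
  assumes "g \<in> carrier G" shows "homeomorphic_map T T (\<lambda>x. g \<otimes> x)"
  using assms continuous_mult_left
  by (auto simp: homeomorphic_map_maps homeomorphic_maps_def mult_inv_cancel_left
      intro!: exI[of _ "\<lambda>x. inv g \<otimes> x"])

lemma homeomorphic_mult_right: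
  assumes "g \<in> carrier G" shows "homeomorphic_map T T (\<lambda>x. x \<otimes> g)"
  using assms continuous_mult_right
  by (auto simp: homeomorphic_map_maps homeomorphic_maps_def m_assoc
      intro!: exI[of _ "\<lambda>x. x \<otimes> inv g"])

lemma homeomorphic_conj_by:
  assumes "y \<in> carrier G" shows "homeomorphic_map T T (conj_by y)"
proof -
  have "homeomorphic_map T T ((\<lambda>x. x \<otimes> y) \<circ> (\<lambda>x. inv y \<otimes> x))"
    using assms by (intro homeomorphic_map_compose[OF homeomorphic_mult_left homeomorphic_mult_right]) auto
  moreover have "conj_by y = (\<lambda>x. x \<otimes> y) \<circ> (\<lambda>x. inv y \<otimes> x)"
    by (rule ext) (simp add: conj_by_def)
  ultimately show ?thesis by simp
qed

lemma r_coset_eq_image: "K #> g = (\<lambda>x. x \<otimes> g) ` K"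
  by (auto simp: r_coset_def)

lemma l_coset_eq_image: "g <# K = (\<lambda>x. g \<otimes> x) ` K"
  by (auto simp: l_coset_def)

lemma openin_r_coset:
  assumes "g \<in> carrier G" "openin T K" shows "openin T (K #> g)"
  unfolding r_coset_eq_image
  using homeomorphic_map_openness[OF homeomorphic_mult_right[OF assms(1)], of K] assms(2) openin_subset[OF assms(2)]
  by simp

lemma closedin_r_coset:
  assumes "g \<in> carrier G" "closedin T K" shows "closedin T (K #> g)"
  unfolding r_coset_eq_image
  using homeomorphic_map_closedness[OF homeomorphic_mult_right[OF assms(1)], of K] assms(2) closedin_subset[OF assms(2)]
  by simp

lemma openin_l_coset:
  assumes "g \<in> carrier G" "openin T K" shows "openin T (g <# K)"
  unfolding l_coset_eq_image
  using homeomorphic_map_openness[OF homeomorphic_mult_left[OF assms(1)], of K] assms(2) openin_subset[OF assms(2)]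
  by simp

lemma closedin_l_coset:
  assumes "g \<in> carrier G" "closedin T K" shows "closedin T (g <# K)"
  unfolding l_coset_eq_image
  using homeomorphic_map_closedness[OF homeomorphic_mult_left[OF assms(1)], of K] assms(2) closedin_subset[OF assms(2)]
  by simp

lemma closedin_set_mult:
  assumes "closedin T A" "closedin T B" shows "closedin T (A <#> B)"
proof -
  have "compactin (prod_topology T T) (A \<times> B)"
    using assms closedin_imp_compactin by (simp add: compactin_Times)
  moreover have "(\<lambda>(x, y). x \<otimes> y) ` (A \<times> B) = A <#> B"
    by (auto simp: set_mult_def)
  ultimately have "compactin T (A <#> B)"
    using image_compactin[OF _ continuous_mult] by metis
  then show ?thesis by (rule compactin_imp_closedin[OF Hausdorff])
qed

lemma openin_set_mult:
  assumes "A \<subseteq> carrier G" "openin T B" shows "openin T (A <#> B)"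
proof -
  have "A <#> B = (\<Union>a\<in>A. a <# B)"
    by (auto simp: set_mult_def l_coset_def)
  moreover have "openin T (a <# B)" if "a \<in> A" for a
    using assms openin_l_coset that by blast
  ultimately show ?thesis by auto
qed

lemma closedin_one: "closedin T {\<one>}"
  by (simp add: closedin_Hausdorff_singleton Hausdorff)

lemma subgroup_closure_of:
  assumes D: "subgroup D G" shows "subgroup (T closure_of D) G"
proof -
  interpret D: subgroup D G by fact
  have sub: "T closure_of D \<subseteq> carrier G"
    using closure_of_subset_topspace[of T D] by simp
  have "(\<lambda>(x, y). x \<otimes> y) ` (prod_topology T T closure_of (D \<times> D)) \<subseteq> T closure_of ((\<lambda>(x, y). x \<otimes> y) ` (D \<times> D))"
    by (rule continuous_map_image_closure_subset[OF continuous_mult])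
  also have "\<dots> \<subseteq> T closure_of D"
    by (rule closure_of_mono) auto
  finally have m: "x \<otimes> y \<in> T closure_of D" if "x \<in> T closure_of D" "y \<in> T closure_of D" for x y
    using that by (force simp: closure_of_Times)
  have "(\<lambda>x. inv x) ` (T closure_of D) \<subseteq> T closure_of ((\<lambda>x. inv x) ` D)"
    by (rule continuous_map_image_closure_subset[OF continuous_inv])
  also have "\<dots> \<subseteq> T closure_of D"
    by (rule closure_of_mono) auto
  finally have i: "inv x \<in> T closure_of D" if "x \<in> T closure_of D" for x
    using that by blast
  have "D \<subseteq> T closure_of D"
    by (rule closure_of_subset) (simp add: D.subset)
  then have "T closure_of D \<noteq> {}"
    using D.one_closed by blast
  then show ?thesis
    using sub m i by (intro subgroupI) auto
qed

text \<open>Serves both directions between open and closed: finite unions of closed cosets are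
  closed, and arbitrary unions of open cosets are open.\<close>

lemma Union_rcosets_minus:
  assumes H: "subgroup H G"
  shows "carrier G - H = \<Union> (rcosets H - {H})"
proof -
  interpret H: subgroup H G by fact
  have "\<Union> (rcosets H) = carrier G" by (rule rcosets_part_G[OF H])
  moreover have "R \<inter> H = {}" if "R \<in> rcosets H - {H}" for R
    using that rcos_disjoint[OF H] H.subgroup_in_rcosets[OF is_group]
    by (auto simp: pairwise_def disjnt_def)
  ultimately show ?thesis by blast
qed

lemma closed_finite_index_imp_open:
  assumes H: "subgroup H G" "closedin T H" "finite (rcosets H)"
  shows "openin T H"
proof -
  have "closedin T (\<Union> (rcosets H - {H}))"
    using H closedin_r_coset by (intro closedin_Union) (auto simp: rcosets_eq_image)
  then have "closedin T (carrier G - H)"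
    using Union_rcosets_minus[OF H(1)] by simp
  then show ?thesis
    using H(1) by (simp add: openin_closedin_eq subgroup.subset)
qed

lemma open_subgroup_closed:
  assumes H: "subgroup H G" "openin T H"
  shows "closedin T H"
proof -
  have "openin T (\<Union> (rcosets H - {H}))"
    using H openin_r_coset by (intro openin_Union) (auto simp: rcosets_eq_image)
  then have "openin T (carrier G - H)"
    using Union_rcosets_minus[OF H(1)] by simp
  then show ?thesis
    using H(1) by (simp add: closedin_def subgroup.subset)
qed

text \<open>Compactness gives a finite cover by cosets; as cosets are nonempty and disjoint, none
  can be missing from it.\<close>

lemma open_subgroup_finite_index:
  assumes H: "subgroup H G" "openin T H"
  shows "finite (rcosets H)"
proof -
  have "\<exists>F. finite F \<and> F \<subseteq> rcosets H \<and> topspace T \<subseteq> \<Union>F"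
    using compact H openin_r_coset rcosets_part_G[OF H(1)]
    unfolding compact_space_alt by (auto simp: rcosets_eq_image)
  then obtain F where F: "finite F" "F \<subseteq> rcosets H" "carrier G \<subseteq> \<Union>F" by auto
  have "rcosets H \<subseteq> F"
  proof
    fix R assume R: "R \<in> rcosets H"
    then obtain x where x: "x \<in> R" "x \<in> carrier G"
      using subgroup.rcosets_non_empty[OF H(1)] rcosets_part_G[OF H(1)] by blast
    then obtain R' where "R' \<in> F" "x \<in> R'" using F by blast
    moreover from this have "R = R'"
      using rcos_disjoint[OF H(1)] F(2) R x unfolding pairwise_def disjnt_def by blast
    ultimately show "R \<in> F" by simp
  qed
  then show ?thesis using F finite_subset by blast
qed

section \<open>Open subgroups containing a given closed subgroup\<close>

text \<open>In a compact Hausdorff space quasi-components coincide with components, which are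
  singletons here; a quasi-component can be separated by a clopen partition from a compact set
  disjoint from it.\<close>

lemma clopen_neighbourhood:
  assumes "x \<in> carrier G" "closedin T Z" "x \<notin> Z"
  obtains K where "openin T K" "closedin T K" "x \<in> K" "K \<inter> Z = {}"
proof -
  let ?C = "quasi_component_of_set T x"
  have C: "?C \<in> quasi_components_of T"
    using assms(1) by (simp add: quasi_component_in_quasi_components_of)
  have "compactin T ?C"
    by (rule closedin_imp_compactin[OF closedin_quasi_component_of])
  then have "?C \<in> connected_components_of T"
    using C compact_quasi_eq_connected_components_of[of T ?C] Hausdorff
      compact_imp_locally_compact_space[OF compact] by blast
  then have "connectedin T ?C" by (rule connectedin_connected_components_of)
  moreover have "x \<in> ?C" using assms(1) by simp
  ultimately have "?C = {x}"
    using profinite unfolding profinite_group_def totally_disconnected_space_def by blast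
  then have "separated_between T {x} Z"
    using separated_between_quasi_component_compact[OF C closedin_imp_compactin[OF assms(2)]] assms(3)
    by simp
  then obtain U V where UV: "openin T U" "openin T V" "U \<union> V = carrier G" "disjnt U V" "x \<in> U" "Z \<subseteq> V"
    by (auto simp: separated_between_def)
  have "U = carrier G - V" using UV by (auto simp: disjnt_def)
  then have "closedin T U" using UV(2) by (metis closedin_topspace closedin_diff topspace_eq)
  then show ?thesis using that UV by (auto simp: disjnt_def)
qed

text \<open>The stabiliser of a clopen set is open by the tube lemma. The set \<open>A <#> K\<close>, for a small
  clopen neighbourhood \<open>K\<close> of the identity, is stabilised by \<open>A\<close> and contains its own stabiliser.\<close>

lemma open_subgroup_separating:
  assumes A: "subgroup A G" "closedin T A" and F: "finite F" "F \<subseteq> carrier G" "F \<inter> A = {}"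
  obtains V where "subgroup V G" "openin T V" "A \<subseteq> V" "V \<inter> F = {}"
proof -
  interpret A: subgroup A G by fact
  \<comment> \<open>If a k = f then k = (inv a) f lies in A f. A set K avoiding these closed cosets
    therefore keeps \<open>A <#> K\<close> disjoint from F.\<close>
  have AF: "closedin T (\<Union>f\<in>F. A #> f)"
    using F A closedin_r_coset by (intro closedin_Union) auto
  have no1: "\<one> \<notin> (\<Union>f\<in>F. A #> f)"
  proof
    assume "\<one> \<in> (\<Union>f\<in>F. A #> f)"
    then obtain f a where f: "f \<in> F" "a \<in> A" "\<one> = a \<otimes> f"
      by (auto simp: r_coset_def)
    then have "inv f = a"
      using F by (intro inv_equality) auto
    then have "f = inv a" using f F by auto
    then show False using f F by auto
  qed
  obtain K where K: "openin T K" "closedin T K" "\<one> \<in> K" "K \<inter> (\<Union>f\<in>F. A #> f) = {}"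
    by (rule clopen_neighbourhood[OF one_closed AF no1])
  have KG: "K \<subseteq> carrier G" using openin_subset[OF K(1)] by simp
  define E where "E = A <#> K"
  have E: "openin T E" "closedin T E"
    using openin_set_mult[OF A.subset K(1)] closedin_set_mult[OF A(2) K(2)] by (auto simp: E_def)
  have EG: "E \<subseteq> carrier G" using openin_subset[OF E(1)] by simp
  have "\<one> \<otimes> \<one> \<in> E" unfolding E_def set_mult_def using K A.one_closed by blast
  then have oneE: "\<one> \<in> E" by simp
  have EF: "E \<inter> F = {}"
  proof -
    have "a \<otimes> k \<notin> F" if "a \<in> A" "k \<in> K" for a k
    proof
      assume "a \<otimes> k \<in> F"
      moreover have "k = inv a \<otimes> (a \<otimes> k)"
        using that KG by (simp add: mult_inv_cancel_left subsetD)
      moreover have "inv a \<in> A" using that by simp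
      ultimately have "k \<in> (\<Union>f\<in>F. A #> f)"
        unfolding r_coset_def by blast
      then show False using that K by blast
    qed
    then show ?thesis by (auto simp: E_def set_mult_def)
  qed
  \<comment> \<open>The two conditions together say g E = E and make closure under inverses
    immediate.\<close>
  define V where "V = {g \<in> carrier G. (\<forall>e\<in>E. g \<otimes> e \<in> E) \<and> (\<forall>e\<in>E. inv g \<otimes> e \<in> E)}"
  have V: "subgroup V G"
  proof (rule subgroupI)
    fix a b assume ab: "a \<in> V" "b \<in> V"
    then have "inv (a \<otimes> b) \<otimes> e = inv b \<otimes> (inv a \<otimes> e)" "a \<otimes> b \<otimes> e = a \<otimes> (b \<otimes> e)" if "e \<in> E" for e
      using that EG by (auto simp: V_def inv_mult_group m_assoc subset_iff)
    then show "a \<otimes> b \<in> V" using ab by (auto simp: V_def)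
  qed (use EG in \<open>auto simp: V_def subset_iff\<close>)
  interpret V: subgroup V G by fact
  have AV: "A \<subseteq> V"
  proof -
    have "a \<otimes> e \<in> E" if ae: "a \<in> A" "e \<in> E" for a e
    proof -
      obtain b k where "b \<in> A" "k \<in> K" "e = b \<otimes> k"
        using ae unfolding E_def set_mult_def by blast
      then have "a \<otimes> e = (a \<otimes> b) \<otimes> k" "a \<otimes> b \<in> A" "k \<in> K"
        using ae KG by (auto simp: m_assoc subset_iff)
      then show ?thesis unfolding E_def set_mult_def by blast
    qed
    then show ?thesis
      unfolding V_def using A.subset A.m_inv_closed by blast
  qed
  have VE: "V \<subseteq> E"
  proof
    fix v assume v: "v \<in> V"
    then have "v \<otimes> \<one> \<in> E" using oneE unfolding V_def by blast
    then show "v \<in> E" using v by simp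
  qed
  have "openin T V"
  proof -
    let ?W = "{p \<in> topspace (prod_topology T T). (\<lambda>(x, y). x \<otimes> y) p \<in> E}"
    have W: "openin (prod_topology T T) ?W"
      using openin_continuous_map_preimage[OF continuous_mult E(1)] by simp
    have EW: "{\<one>} \<times> E \<subseteq> ?W" using EG by auto
    have cpt: "compactin T {\<one>}" "compactin T E"
      using closedin_imp_compactin closedin_one E by auto
    obtain P Q where PQ: "openin T P" "openin T Q" "{\<one>} \<subseteq> P" "E \<subseteq> Q" "P \<times> Q \<subseteq> ?W"
      by (rule Wallace_theorem_prod_topology[OF cpt W EW])
    \<comment> \<open>P maps E into itself under left multiplication; its symmetric part N then lies
      in V, and V = V N is open.\<close>
    define N where "N = {x \<in> carrier G. x \<in> P \<and> inv x \<in> P}"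
    have "openin T {x \<in> topspace T. inv x \<in> P}"
      using openin_continuous_map_preimage[OF continuous_inv PQ(1)] .
    then have "openin T (P \<inter> {x \<in> topspace T. inv x \<in> P})"
      using PQ(1) by blast
    then have N: "openin T N"
      by (simp add: N_def Int_def conj_ac)
    have N1: "\<one> \<in> N" using PQ(3) by (simp add: N_def)
    have "x \<otimes> e \<in> E" if "x \<in> P" "e \<in> E" for x e
    proof -
      have "(x, e) \<in> P \<times> Q" using PQ(4) that by blast
      from subsetD[OF PQ(5) this] show ?thesis by simp
    qed
    then have NV: "N \<subseteq> V"
      unfolding N_def V_def by blast
    have "V = V <#> N"
    proof
      have "v \<otimes> \<one> \<in> V <#> N" if "v \<in> V" for v
        unfolding set_mult_def using N1 that by blast
      then show "V \<subseteq> V <#> N" by auto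
      show "V <#> N \<subseteq> V" using NV by (auto simp: set_mult_def)
    qed
    then show ?thesis using openin_set_mult[OF V.subset N] by simp
  qed
  then show ?thesis using that[OF V] AV VE EF by blast
qed

text \<open>Take representatives of N distinct A-cosets and separate A from their finitely many
  quotients x (inv y). The representatives then stay in distinct V-cosets.\<close>

lemma open_subgroup_large_index:
  assumes A: "subgroup A G" "closedin T A" and inf: "infinite (rcosets A)"
  obtains V where "subgroup V G" "openin T V" "A \<subseteq> V" "N \<le> card (rcosets V)"
proof -
  obtain \<R> where R: "\<R> \<subseteq> rcosets A" "card \<R> = N" "finite \<R>"
    using infinite_arbitrarily_large[OF inf] by blast
  obtain Y where Y: "Y \<subseteq> carrier G" "inj_on ((#>) A) Y" "\<R> = (#>) A ` Y"
    using subset_image_inj[of \<R> "(#>) A" "carrier G"] R(1) rcosets_eq_image[of A] by auto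
  have finY: "finite Y" and cardY: "card Y = N"
    using Y R finite_imageD card_image by fastforce+
  define F where "F = (\<lambda>(x, y). x \<otimes> inv y) ` {p \<in> Y \<times> Y. fst p \<noteq> snd p}"
  have "x \<otimes> inv y \<notin> A" if "x \<in> Y" "y \<in> Y" "x \<noteq> y" for x y
    using Y(1) inj_onD[OF Y(2), of x y] rcoset_eq_iff[OF A(1), of x y] that by blast
  then have "F \<inter> A = {}"
    by (auto simp: F_def)
  moreover have "finite F" "F \<subseteq> carrier G"
    using finY Y by (auto simp: F_def)
  ultimately obtain V where V: "subgroup V G" "openin T V" "A \<subseteq> V" "V \<inter> F = {}"
    using open_subgroup_separating[OF A] by metis
  have "inj_on ((#>) V) Y"
  proof (rule inj_onI, rule ccontr)
    fix x y assume xy: "x \<in> Y" "y \<in> Y" "V #> x = V #> y" "x \<noteq> y"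
    then have "x \<otimes> inv y \<in> F" by (force simp: F_def)
    moreover have "x \<otimes> inv y \<in> V" using rcoset_eq_iff[OF V(1)] xy Y by blast
    ultimately show False using V by blast
  qed
  then have "N = card ((#>) V ` Y)" using cardY by (simp add: card_image)
  also have "\<dots> \<le> card (rcosets V)"
    using open_subgroup_finite_index[OF V(1,2)] Y by (intro card_mono) (auto simp: rcosets_eq_image)
  finally show ?thesis using that V by blast
qed

section \<open>Thin subgroups and the rank gradient\<close>

definition thin :: "'a set \<Rightarrow> bool" where
  "thin H \<longleftrightarrow> closed_subgroup G T H \<and> top_fin_gen G T H \<and> infinite (rcosets H)"

lemma thin_subgroup: "thin H \<Longrightarrow> subgroup H G"
  and thin_closedin: "thin H \<Longrightarrow> closedin T H"
  and thin_infinite: "thin H \<Longrightarrow> infinite (rcosets H)"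
  by (simp_all add: thin_def closed_subgroup_def)

lemma thin_generators:
  assumes "thin H"
  obtains S where "finite S" "S \<subseteq> H" "H \<subseteq> T closure_of (generate G S)"
  using assms by (auto simp: thin_def top_fin_gen_def top_generates_def)

text \<open>Conjugation is both an automorphism and a homeomorphism, so it commutes with generating
  and with closure.\<close>

lemma thin_conj_by:
  assumes "thin H" "y \<in> carrier G"
  shows "thin (conj_by y ` H)"
proof -
  interpret f: group_hom G G "conj_by y"
    by (rule conj_by_hom[OF assms(2)])
  have H: "subgroup H G" and HG: "H \<subseteq> carrier G"
    using thin_subgroup[OF assms(1)] subgroup.subset by auto
  have hom: "homeomorphic_map T T (conj_by y)"
    by (rule homeomorphic_conj_by[OF assms(2)])
  obtain S where S: "finite S" "S \<subseteq> H" "H \<subseteq> T closure_of (generate G S)"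
    using thin_generators[OF assms(1)] .
  have SG: "S \<subseteq> carrier G" using S HG by auto
  have "conj_by y ` H \<subseteq> conj_by y ` (T closure_of (generate G S))"
    using S by blast
  also have "\<dots> = T closure_of (conj_by y ` generate G S)"
    using homeomorphic_map_closure_of[OF hom, of "generate G S"] generate_incl[OF SG] by simp
  also have "\<dots> = T closure_of (generate G (conj_by y ` S))"
    using f.generate_img[OF SG] by simp
  finally have "top_generates G T (conj_by y ` S) (conj_by y ` H)"
    using S by (auto simp: top_generates_def)
  moreover have "closedin T (conj_by y ` H)"
    using homeomorphic_map_closedness[OF hom, of H] HG thin_closedin[OF assms(1)] by simp
  ultimately show ?thesis
    using infinite_rcosets_conj_by[OF assms(2) HG thin_infinite[OF assms(1)]]
      f.subgroup_img_is_subgroup[OF H] S(1)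
    unfolding thin_def closed_subgroup_def top_fin_gen_def by blast
qed

lemma rank_gradient_le:
  assumes "subgroup U G" "openin T U"
  shows "rank_gradient G T \<le> (real (dgen G T U) - 1) / real (card (rcosets U))"
proof -
  \<comment> \<open>\<open>cInf_lower\<close> requires a lower bound. An infinite index counts as 0,
    where the quotient is 0 by convention.\<close>
  have "-1 \<le> (real (dgen G T U) - 1) / real (group_index G U)" for U
  proof (cases "group_index G U = 0")
    case False
    then show ?thesis by (simp add: field_simps)
  qed simp
  then have "bdd_below {(real (dgen G T U) - 1) / real (group_index G U) | U. open_subgroup G T U}"
    by (intro bdd_belowI[of _ "-1"]) auto
  then show ?thesis
    unfolding rank_gradient_def group_index_def[symmetric]
    using assms by (intro cInf_lower) (auto simp: open_subgroup_def)
qed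

lemma dgen_le:
  assumes "finite S" "top_generates G T S H"
  shows "dgen G T H \<le> card S"
  unfolding dgen_def using assms by (intro Least_le) auto

lemma card_rcosets_pos:
  assumes "subgroup U G" "openin T U"
  shows "card (rcosets U) > 0"
  using open_subgroup_finite_index[OF assms] subgroup.subgroup_in_rcosets[OF assms(1) is_group]
  by (auto simp: card_gt_0_iff)

text \<open>Were the index finite, \<open>{\<one>}\<close> would be open and generated by the empty
  set, and its quotient (0 - 1) / |G| would lie below the positive infimum.\<close>

lemma thin_one:
  assumes "rank_gradient G T > 0"
  shows "thin {\<one>}"
proof -
  have sub: "subgroup {\<one>} G" by (rule triv_subgroup)
  have gen: "top_generates G T {} {\<one>}"
    using closure_of_subset[of "generate G {}" T] generate.one[of G "{}"] generate_incl[of "{}"]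
    by (auto simp: top_generates_def)
  have "infinite (rcosets {\<one>})"
  proof
    assume fin: "finite (rcosets {\<one>})"
    have op: "openin T {\<one>}"
      by (rule closed_finite_index_imp_open[OF sub closedin_one fin])
    have "dgen G T {\<one>} = 0" using dgen_le[OF _ gen] by simp
    then have "(real (dgen G T {\<one>}) - 1) / real (card (rcosets {\<one>})) < 0"
      using card_rcosets_pos[OF sub op] by simp
    then show False using rank_gradient_le[OF sub op] assms by linarith
  qed
  then show ?thesis
    using sub closedin_one gen by (auto simp: thin_def closed_subgroup_def top_fin_gen_def)
qed

text \<open>With \<open>a = d(A)\<close> and \<open>b = d(B)\<close>, the Schreier bound gives
  \<open>d(C) \<le> a [A : A \<inter> U] + b [B : B \<inter> V] \<le> (a / [G : V] + b / [G : U]) [G : U \<inter> V]\<close>,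
  which for \<open>U\<close>, \<open>V\<close> of large index is too small for an open subgroup \<open>C \<subseteq> U \<inter> V\<close>.\<close>

lemma thin_join_of_open_subgroups:
  assumes A: "thin A" and B: "thin B" and pos: "rank_gradient G T > 0"
  obtains C U V where "thin C" "subgroup U G" "openin T U" "subgroup V G" "openin T V"
    "A \<inter> U \<subseteq> C" "B \<inter> V \<subseteq> C"
proof -
  define \<rho> where "\<rho> = rank_gradient G T"
  obtain S where S: "finite S" "S \<subseteq> A" "A \<subseteq> T closure_of (generate G S)"
    using thin_generators[OF A] .
  obtain R where R: "finite R" "R \<subseteq> B" "B \<subseteq> T closure_of (generate G R)"
    using thin_generators[OF B] .
  have SG: "S \<subseteq> carrier G" and RG: "R \<subseteq> carrier G"
    using S R subgroup.subset[OF thin_subgroup[OF A]] subgroup.subset[OF thin_subgroup[OF B]] by auto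
  \<comment> \<open>The factor 2 leaves a margin: for N > 0 it forces card P + card Q \<le> \<rho> m
    / 2.\<close>
  define N where "N = nat \<lceil>2 * (real (card S) + real (card R)) / \<rho>\<rceil>"
  have N: "2 * (real (card S) + real (card R)) / \<rho> \<le> real N"
    unfolding N_def by linarith
  obtain U where U: "subgroup U G" "openin T U" "B \<subseteq> U" "N \<le> card (rcosets U)"
    by (rule open_subgroup_large_index[OF thin_subgroup[OF B] thin_closedin[OF B] thin_infinite[OF B]])
  obtain V where V: "subgroup V G" "openin T V" "A \<subseteq> V" "N \<le> card (rcosets V)"
    by (rule open_subgroup_large_index[OF thin_subgroup[OF A] thin_closedin[OF A] thin_infinite[OF A]])
  have genA: "generate G S \<subseteq> A" and genB: "generate G R \<subseteq> B"
    using generate_subgroup_incl[OF S(2) thin_subgroup[OF A]]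
      generate_subgroup_incl[OF R(2) thin_subgroup[OF B]] by auto
  have finU: "finite ((#>) U ` generate G S)"
    by (rule finite_subset[OF _ open_subgroup_finite_index[OF U(1,2)]])
      (use generate_incl[OF SG] in \<open>auto simp: rcosets_eq_image\<close>)
  have finV: "finite ((#>) V ` generate G R)"
    by (rule finite_subset[OF _ open_subgroup_finite_index[OF V(1,2)]])
      (use generate_incl[OF RG] in \<open>auto simp: rcosets_eq_image\<close>)
  obtain P where P: "finite P" "P \<subseteq> generate G S \<inter> U"
      "card P \<le> card S * card ((#>) U ` generate G S)" "generate G S \<inter> U \<subseteq> generate G P"
    by (rule schreier_generators[OF SG S(1) U(1) finU])
  obtain Q where Q: "finite Q" "Q \<subseteq> generate G R \<inter> V"
      "card Q \<le> card R * card ((#>) V ` generate G R)" "generate G R \<inter> V \<subseteq> generate G Q"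
    by (rule schreier_generators[OF RG R(1) V(1) finV])
  have UV: "subgroup (U \<inter> V) G" "openin T (U \<inter> V)"
    using U V by (auto intro: subgroups_Inter_pair)
  define m where "m = card (rcosets (U \<inter> V))"
  have finUV: "finite (rcosets (U \<inter> V))"
    by (rule open_subgroup_finite_index[OF UV])
  \<comment> \<open>P lies in A, hence in V, and Q lies in B, hence in U.\<close>
  have PQUV: "P \<union> Q \<subseteq> U \<inter> V"
    using P(2) Q(2) genA genB U(3) V(3) by blast
  have PQG: "P \<union> Q \<subseteq> carrier G"
    using PQUV subgroup.subset[OF UV(1)] by blast
  define C where "C = T closure_of (generate G (P \<union> Q))"
  have C: "subgroup C G" "closedin T C"
    unfolding C_def using subgroup_closure_of[OF generate_is_subgroup[OF PQG]] by auto
  have gen_sub: "generate G (P \<union> Q) \<subseteq> C"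
    unfolding C_def using generate_incl[OF PQG] by (intro closure_of_subset) simp
  have gen: "top_generates G T (P \<union> Q) C"
    using gen_sub generate.incl[of _ "P \<union> Q" G] by (auto simp: top_generates_def C_def)
  have CUV: "C \<subseteq> U \<inter> V"
    unfolding C_def
    by (rule closure_of_minimal[OF generate_subgroup_incl[OF PQUV UV(1)] open_subgroup_closed[OF UV]])
  have "infinite (rcosets C)"
  proof
    assume fin: "finite (rcosets C)"
    have op: "openin T C" by (rule closed_finite_index_imp_open[OF C fin])
    have m_le: "m \<le> card (rcosets C)"
      unfolding m_def rcosets_supergroup_eq_image[OF C(1) UV(1) CUV]
      by (rule card_image_le[OF fin])
    have m_pos: "m > 0" unfolding m_def by (rule card_rcosets_pos[OF UV])
    have "\<rho> \<le> (real (dgen G T C) - 1) / real (card (rcosets C))"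
      unfolding \<rho>_def by (rule rank_gradient_le[OF C(1) op])
    then have "\<rho> * real (card (rcosets C)) \<le> real (dgen G T C) - 1"
      using card_rcosets_pos[OF C(1) op] by (simp add: field_simps)
    moreover have "\<rho> * real m \<le> \<rho> * real (card (rcosets C))"
      using m_le pos by (intro mult_left_mono) (auto simp: \<rho>_def)
    moreover have "dgen G T C \<le> card P + card Q"
      using dgen_le[OF _ gen] P(1) Q(1) card_Un_le[of P Q] by simp
    \<comment> \<open>The summand 1 comes from d(C) - 1; it decides the degenerate case N = 0
      below.\<close>
    ultimately have 1: "\<rho> * real m + 1 \<le> real (card P) + real (card Q)"
      by linarith
    have k: "real (card P) * real N \<le> real (card S) * real m"
    proof -
      have "card P * N \<le> card S * card ((#>) U ` generate G S) * card (rcosets V)"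
        using P(3) V(4) by (rule mult_le_mono)
      also have "\<dots> \<le> card S * m"
        using card_rcosets_Int_ge[OF U(1) V(1) _ finUV, of "generate G S"] genA V(3)
        by (simp add: m_def mult.assoc)
      finally show ?thesis by (metis of_nat_mono of_nat_mult)
    qed
    have l: "real (card Q) * real N \<le> real (card R) * real m"
    proof -
      have "card Q * N \<le> card R * card ((#>) V ` generate G R) * card (rcosets U)"
        using Q(3) U(4) by (rule mult_le_mono)
      also have "\<dots> \<le> card R * m"
        using card_rcosets_Int_ge[OF V(1) U(1), of "generate G R"] finUV genB U(3)
        by (simp add: m_def mult.assoc Int_commute)
      finally show ?thesis by (metis of_nat_mono of_nat_mult)
    qed
    \<comment> \<open>Combining the bounds gives 2 (\<rho> m + 1) N \<le> \<rho> N m, which is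
      impossible for N > 0.\<close>
    have "(\<rho> * real m + 1) * real N \<le> (real (card P) + real (card Q)) * real N"
      using 1 by (intro mult_right_mono) auto
    also have "\<dots> \<le> (real (card S) + real (card R)) * real m"
      using k l by (simp add: algebra_simps)
    also have "2 * \<dots> \<le> \<rho> * real N * real m"
    proof -
      have "2 * (real (card S) + real (card R)) \<le> \<rho> * real N"
        using N pos by (simp add: \<rho>_def field_simps)
      then show ?thesis
        using mult_right_mono[of _ _ "real m"] by (simp flip: mult.assoc)
    qed
    finally have "2 * ((\<rho> * real m + 1) * real N) \<le> \<rho> * real N * real m" by simp
    moreover have "0 \<le> \<rho> * real N * real m" using pos by (simp add: \<rho>_def)
    ultimately have "real N \<le> 0" by (simp add: algebra_simps)
    \<comment> \<open>N = 0 forces S and R to be empty, hence also P and Q, and then inequality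
      \<open>1\<close> fails.\<close>
    then have "N = 0" by simp
    then have "2 * (real (card S) + real (card R)) / \<rho> \<le> 0" using N by simp
    then have "real (card S) + real (card R) \<le> 0"
      using pos by (simp add: \<rho>_def divide_le_0_iff)
    then have "card S = 0" "card R = 0" by linarith+
    then have "card P = 0" "card Q = 0" using P(3) Q(3) by simp_all
    then have "\<rho> * real m + 1 \<le> 0" using 1 by simp
    moreover have "0 \<le> \<rho> * real m" using pos by (simp add: \<rho>_def)
    ultimately show False by linarith
  qed
  then have "thin C"
    using C gen P(1) Q(1) unfolding thin_def closed_subgroup_def top_fin_gen_def by blast
  moreover have "A \<inter> U \<subseteq> C"
  proof -
    \<comment> \<open>Because U is open, elements of the dense subgroup that lie in U already
      approximate all of A \<inter> U, so the abstract Schreier generators suffice.\<close>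
    have "U \<inter> A \<subseteq> T closure_of (U \<inter> generate G S)"
      using S(3) openin_Int_closure_of_subset[OF U(2), of "generate G S"] by blast
    also have "\<dots> \<subseteq> C"
      unfolding C_def using P(4) mono_generate[of P "P \<union> Q"] by (intro closure_of_mono) blast
    finally show ?thesis by blast
  qed
  moreover have "B \<inter> V \<subseteq> C"
  proof -
    have "V \<inter> B \<subseteq> T closure_of (V \<inter> generate G R)"
      using R(3) openin_Int_closure_of_subset[OF V(2), of "generate G R"] by blast
    also have "\<dots> \<subseteq> C"
      unfolding C_def using Q(4) mono_generate[of Q "P \<union> Q"] by (intro closure_of_mono) blast
    finally show ?thesis by blast
  qed
  ultimately show ?thesis using that U V by blast
qed

section \<open>Coverings by finitely many cosets of thin subgroups\<close>

definition covered :: "'a set \<Rightarrow> bool" where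
  "covered E \<longleftrightarrow> (\<exists>F. finite F \<and> F \<subseteq> carrier G \<times> Collect thin \<and> E \<subseteq> (\<Union>(g, K)\<in>F. g <# K))"

lemma coveredI:
  assumes "g \<in> carrier G" "thin K" "E \<subseteq> g <# K"
  shows "covered E"
  unfolding covered_def using assms by (intro exI[of _ "{(g, K)}"]) auto

lemma covered_mono:
  assumes "covered E" "D \<subseteq> E"
  shows "covered D"
proof -
  obtain F where F: "finite F" "F \<subseteq> carrier G \<times> Collect thin" "E \<subseteq> (\<Union>(g, K)\<in>F. g <# K)"
    using assms(1) unfolding covered_def by blast
  show ?thesis
    unfolding covered_def by (intro exI[of _ F] conjI F(1,2) subset_trans[OF assms(2) F(3)])
qed

lemma covered_UN:
  assumes "finite I" "\<And>i. i \<in> I \<Longrightarrow> covered (E i)"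
  shows "covered (\<Union>i\<in>I. E i)"
proof -
  obtain F where F: "\<And>i. i \<in> I \<Longrightarrow> finite (F i) \<and> F i \<subseteq> carrier G \<times> Collect thin
      \<and> E i \<subseteq> (\<Union>(g, K)\<in>F i. g <# K)"
    using assms(2) unfolding covered_def by metis
  show ?thesis
    unfolding covered_def
  proof (intro exI conjI)
    show "finite (\<Union>i\<in>I. F i)" using assms(1) F by blast
    show "(\<Union>i\<in>I. F i) \<subseteq> carrier G \<times> Collect thin" using F by blast
    show "(\<Union>i\<in>I. E i) \<subseteq> (\<Union>(g, K)\<in>(\<Union>i\<in>I. F i). g <# K)"
    proof
      fix x assume "x \<in> (\<Union>i\<in>I. E i)"
      then obtain i where i: "i \<in> I" "x \<in> E i" by blast
      then have "x \<in> (\<Union>(g, K)\<in>F i. g <# K)" using F by blast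
      then show "x \<in> (\<Union>(g, K)\<in>(\<Union>i\<in>I. F i). g <# K)" using i by blast
    qed
  qed
qed

text \<open>Only finitely many U-cosets meet A. Representatives chosen inside A make a (inv z) lie
  in A as well as in U.\<close>

lemma finite_transversal:
  assumes A: "subgroup A G" and U: "subgroup U G" "openin T U"
  obtains Z where "finite Z" "Z \<subseteq> A" "\<And>a. a \<in> A \<Longrightarrow> \<exists>z\<in>Z. a \<otimes> inv z \<in> A \<inter> U"
proof -
  interpret A: subgroup A G by fact
  obtain Z where Z: "Z \<subseteq> A" "inj_on ((#>) U) Z" "(#>) U ` A = (#>) U ` Z"
    using subset_image_inj[of "(#>) U ` A" "(#>) U" A] by auto
  have "finite ((#>) U ` Z)"
    by (rule finite_subset[OF _ open_subgroup_finite_index[OF U]])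
      (use Z(1) A.subset in \<open>auto simp: rcosets_eq_image\<close>)
  then have "finite Z" using Z(2) by (rule finite_imageD)
  moreover have "\<exists>z\<in>Z. a \<otimes> inv z \<in> A \<inter> U" if a: "a \<in> A" for a
  proof -
    have "U #> a \<in> (#>) U ` Z" using a Z(3) by blast
    then obtain z where z: "z \<in> Z" "U #> a = U #> z" by blast
    then have "z \<in> A" "z \<in> carrier G" "a \<in> carrier G" using Z(1) A.subset a by auto
    then show ?thesis using z a rcoset_eq_iff[OF U(1), of a z] by blast
  qed
  ultimately show ?thesis using that Z(1) by blast
qed

text \<open>A is a finite union of sets (inv y) (A \<inter> U) and B of sets (B \<inter> V) z. Hence
  A B lies in the union of the sets (inv y) C z, each equal to the left coset of
  \<open>conj_by z\<close> \<open>C\<close> at (inv y) z.\<close>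

lemma covered_mult_thin:
  assumes A: "thin A" and B: "thin B" and pos: "rank_gradient G T > 0"
  shows "covered (A <#> B)"
proof -
  interpret A: subgroup A G by (rule thin_subgroup[OF A])
  interpret B: subgroup B G by (rule thin_subgroup[OF B])
  obtain C U V where C: "thin C" and U: "subgroup U G" "openin T U"
    and V: "subgroup V G" "openin T V" and sub: "A \<inter> U \<subseteq> C" "B \<inter> V \<subseteq> C"
    by (rule thin_join_of_open_subgroups[OF A B pos])
  interpret C: subgroup C G by (rule thin_subgroup[OF C])
  obtain Y where Y: "finite Y" "Y \<subseteq> A" "\<And>a. a \<in> A \<Longrightarrow> \<exists>y\<in>Y. a \<otimes> inv y \<in> A \<inter> U"
    using finite_transversal[OF A.subgroup_axioms U] by metis
  obtain Z where Z: "finite Z" "Z \<subseteq> B" "\<And>b. b \<in> B \<Longrightarrow> \<exists>z\<in>Z. b \<otimes> inv z \<in> B \<inter> V"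
    using finite_transversal[OF B.subgroup_axioms V] by metis
  let ?E = "\<lambda>(y, z). (inv y \<otimes> z) <# (conj_by z ` C)"
  have "covered (\<Union>p\<in>Y \<times> Z. ?E p)"
  proof (rule covered_UN)
    fix p assume "p \<in> Y \<times> Z"
    then obtain y z where p: "p = (y, z)" "y \<in> Y" "z \<in> Z" by blast
    have "y \<in> carrier G" "z \<in> carrier G"
      using p Y(2) Z(2) A.subset B.subset by auto
    then show "covered (?E p)"
      unfolding p(1) using coveredI[OF _ thin_conj_by[OF C], of "inv y \<otimes> z" z] by simp
  qed (use Y Z in auto)
  moreover have "A <#> B \<subseteq> (\<Union>p\<in>Y \<times> Z. ?E p)"
  proof
    fix x assume "x \<in> A <#> B"
    then obtain a b where ab: "a \<in> A" "b \<in> B" "x = a \<otimes> b"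
      unfolding set_mult_def by blast
    \<comment> \<open>The transversal concerns right cosets; applying it to inv a gives the left
      coset decomposition of A.\<close>
    obtain y where y: "y \<in> Y" "inv a \<otimes> inv y \<in> A \<inter> U"
      using Y(3)[of "inv a"] ab by blast
    obtain z where z: "z \<in> Z" "b \<otimes> inv z \<in> B \<inter> V"
      using Z(3)[OF ab(2)] by blast
    have c: "a \<in> carrier G" "b \<in> carrier G" "y \<in> carrier G" "z \<in> carrier G"
      using ab y z Y(2) Z(2) A.subset B.subset by auto
    define u where "u = inv (inv a \<otimes> inv y) \<otimes> (b \<otimes> inv z)"
    have uC: "u \<in> C"
      unfolding u_def using y z sub by blast
    have "x = (inv y \<otimes> z) \<otimes> conj_by z u"
      unfolding ab(3) u_def conj_by_def using c
      by (simp add: inv_mult_group m_assoc mult_inv_cancel_left)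
    then have "x \<in> ?E (y, z)"
      using uC unfolding l_coset_def by auto
    then show "x \<in> (\<Union>p\<in>Y \<times> Z. ?E p)" using y z by blast
  qed
  ultimately show ?thesis by (rule covered_mono)
qed

lemma covered_l_coset:
  assumes "g \<in> carrier G" "covered E"
  shows "covered (g <# E)"
proof -
  obtain F where F: "finite F" "F \<subseteq> carrier G \<times> Collect thin" "E \<subseteq> (\<Union>(h, K)\<in>F. h <# K)"
    using assms(2) unfolding covered_def by blast
  have "covered (\<Union>p\<in>F. (g \<otimes> fst p) <# snd p)"
  proof (rule covered_UN[OF F(1)])
    fix p assume "p \<in> F"
    then have "fst p \<in> carrier G" "thin (snd p)" using F(2) by auto
    then show "covered ((g \<otimes> fst p) <# snd p)"
      using coveredI[OF _ _ subset_refl] assms(1) by blast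
  qed
  moreover have "g <# E \<subseteq> (\<Union>p\<in>F. (g \<otimes> fst p) <# snd p)"
  proof
    fix x assume "x \<in> g <# E"
    then obtain e where e: "e \<in> E" "x = g \<otimes> e" unfolding l_coset_def by blast
    then obtain h K where hK: "(h, K) \<in> F" "e \<in> h <# K" using F(3) by blast
    then obtain k where k: "k \<in> K" "e = h \<otimes> k" unfolding l_coset_def by blast
    have "h \<in> carrier G" "k \<in> carrier G"
      using hK k F(2) thin_subgroup subgroup.mem_carrier by fast+
    then have "x = (g \<otimes> h) \<otimes> k" using e k assms(1) by (simp add: m_assoc)
    then have "x \<in> (g \<otimes> h) <# K" using k unfolding l_coset_def by blast
    then show "x \<in> (\<Union>p\<in>F. (g \<otimes> fst p) <# snd p)" using hK by force
  qed
  ultimately show ?thesis by (rule covered_mono)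
qed

text \<open>Since A g K = g (inv g A g) K, each coset in the cover reduces to a product of two thin
  subgroups.\<close>

lemma covered_thin_mult:
  assumes A: "thin A" and E: "covered E" and pos: "rank_gradient G T > 0"
  shows "covered (A <#> E)"
proof -
  obtain F where F: "finite F" "F \<subseteq> carrier G \<times> Collect thin" "E \<subseteq> (\<Union>(g, K)\<in>F. g <# K)"
    using E unfolding covered_def by blast
  let ?E = "\<lambda>(g, K). g <# (conj_by g ` A <#> K)"
  have "covered (\<Union>p\<in>F. ?E p)"
    using F(1)
  proof (rule covered_UN)
    fix p assume p: "p \<in> F"
    obtain g K where gK: "p = (g, K)" by force
    then have "g \<in> carrier G" "thin K" using p F(2) by auto
    then show "covered (?E p)"
      unfolding gK using A pos by (auto intro!: covered_l_coset covered_mult_thin thin_conj_by)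
  qed
  moreover have "A <#> E \<subseteq> (\<Union>p\<in>F. ?E p)"
  proof
    fix x assume "x \<in> A <#> E"
    then obtain a e where ae: "a \<in> A" "e \<in> E" "x = a \<otimes> e" unfolding set_mult_def by blast
    then obtain g K where gK: "(g, K) \<in> F" "e \<in> g <# K" using F(3) by blast
    then obtain k where k: "k \<in> K" "e = g \<otimes> k" unfolding l_coset_def by blast
    have c: "g \<in> carrier G" "k \<in> carrier G" "a \<in> carrier G"
      using gK k ae F(2) A thin_subgroup subgroup.mem_carrier by fast+
    then have "x = g \<otimes> (conj_by g a \<otimes> k)"
      by (simp add: ae k conj_by_def m_assoc mult_inv_cancel_left)
    then have "x \<in> ?E (g, K)" using k ae unfolding l_coset_def set_mult_def by auto
    then show "x \<in> (\<Union>p\<in>F. ?E p)" using gK by blast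
  qed
  ultimately show ?thesis by (rule covered_mono)
qed

lemma covered_prod_sets:
  assumes "rank_gradient G T > 0" "\<forall>A\<in>set As. thin A"
  shows "covered (prod_sets G As)"
  using assms(2)
proof (induction As)
  case Nil
  show ?case
    using coveredI[OF one_closed thin_one[OF assms(1)]] by (simp add: l_coset_def)
next
  case (Cons A As)
  then show ?case using covered_thin_mult[OF _ _ assms(1)] by simp
qed

section \<open>Haar measure of thin subgroups and of covered sets\<close>

lemma closedin_borel:
  assumes "closedin T K" shows "K \<in> borel_sets_of T"
proof -
  have "carrier G - (carrier G - K) \<in> borel_sets_of T"
    unfolding borel_sets_of_def using assms
    by (simp add: sigma_sets.Compl sigma_sets.Basic closedin_def)
  then show ?thesis using closedin_subset[OF assms] by (simp add: double_diff)
qed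

text \<open>Infinite index provides, for every N, N disjoint translates of K of equal measure, whose
  total is at most 1.\<close>

lemma emeasure_thin:
  assumes M: "normalized_haar G T M" and K: "thin K"
  shows "emeasure M K = 0"
proof -
  interpret prob_space M using M by (simp add: normalized_haar_def)
  have sets: "L \<in> sets M" if "closedin T L" for L
    using M closedin_borel[OF that] by (simp add: normalized_haar_def)
  have trans: "measure M (g <# K) = measure M K" if "g \<in> carrier G" for g
    using M sets[OF thin_closedin[OF K]] that
    by (simp add: normalized_haar_def l_coset_eq_image measure_def)
  interpret K: subgroup K G by (rule thin_subgroup[OF K])
  have bound: "real N * measure M K \<le> 1" for N
  proof -
    obtain \<R> where R: "\<R> \<subseteq> rcosets K" "card \<R> = N" "finite \<R>"
      using infinite_arbitrarily_large[OF thin_infinite[OF K]] by blast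
    obtain Y where Y: "Y \<subseteq> carrier G" "inj_on ((#>) K) Y" "\<R> = (#>) K ` Y"
      using subset_image_inj[of \<R> "(#>) K" "carrier G"] R(1) rcosets_eq_image[of K] by auto
    have finY: "finite Y" and cardY: "card Y = N"
      using Y R finite_imageD card_image by fastforce+
    \<comment> \<open>The index counts right cosets K y, whereas the measure is left invariant;
      inversion turns K y into (inv y) K.\<close>
    have disj: "disjoint_family_on (\<lambda>y. inv y <# K) Y"
      unfolding disjoint_family_on_def
    proof (intro ballI impI, rule ccontr)
      fix x y assume xy: "x \<in> Y" "y \<in> Y" "x \<noteq> y" "(inv x <# K) \<inter> (inv y <# K) \<noteq> {}"
      then obtain k l where kl: "k \<in> K" "l \<in> K" "inv x \<otimes> k = inv y \<otimes> l"
        unfolding l_coset_def by blast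
      have c: "x \<in> carrier G" "y \<in> carrier G" "k \<in> carrier G" "l \<in> carrier G"
        using xy kl Y(1) by auto
      have "x \<otimes> inv y = x \<otimes> (inv y \<otimes> l) \<otimes> inv l"
        using c by (simp add: m_assoc)
      also have "\<dots> = k \<otimes> inv l"
        using c by (simp add: kl(3)[symmetric] mult_inv_cancel_left)
      finally have "x \<otimes> inv y \<in> K" using kl by auto
      then have "K #> x = K #> y" using rcoset_eq_iff[OF K.subgroup_axioms c(1,2)] by simp
      then show False using inj_onD[OF Y(2)] xy by blast
    qed
    have "real N * measure M K = (\<Sum>y\<in>Y. measure M (inv y <# K))"
      using Y(1) trans cardY by (simp add: subset_iff)
    also have "\<dots> = measure M (\<Union>y\<in>Y. inv y <# K)"
      using Y(1) finY disj sets closedin_l_coset thin_closedin[OF K]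
      by (intro finite_measure_finite_Union[symmetric]) (auto simp: image_subset_iff subset_iff)
    also have "\<dots> \<le> 1" by (rule prob_le_1)
    finally show ?thesis .
  qed
  have "measure M K = 0"
  proof (rule ccontr)
    assume "measure M K \<noteq> 0"
    then have "measure M K > 0" by (simp add: zero_less_measure_iff)
    then obtain N where "1 < real N * measure M K" using reals_Archimedean3 by blast
    then show False using bound[of N] by simp
  qed
  then show ?thesis by (simp add: emeasure_eq_measure)
qed

lemma emeasure_covered:
  assumes M: "normalized_haar G T M" and E: "covered E"
  shows "emeasure M E = 0"
proof -
  obtain F where F: "finite F" "F \<subseteq> carrier G \<times> Collect thin" "E \<subseteq> (\<Union>(g, K)\<in>F. g <# K)"
    using E unfolding covered_def by blast
  have null: "(\<Union>p\<in>F. fst p <# snd p) \<in> null_sets M"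
  proof (rule null_sets_UN'[OF countable_finite[OF F(1)]])
    fix p assume "p \<in> F"
    then have p: "fst p \<in> carrier G" "thin (snd p)" using F(2) by auto
    have K: "snd p \<in> sets M" "fst p <# snd p \<in> sets M"
      using M closedin_borel thin_closedin[OF p(2)] closedin_l_coset[OF p(1)]
      by (auto simp: normalized_haar_def)
    have "emeasure M (fst p <# snd p) = emeasure M (snd p)"
      using M p(1) K(1) unfolding normalized_haar_def l_coset_eq_image by blast
    then show "fst p <# snd p \<in> null_sets M"
      using emeasure_thin[OF M p(2)] K by auto
  qed
  have "E \<subseteq> (\<Union>p\<in>F. fst p <# snd p)" using F(3) by (auto simp: split_def)
  \<comment> \<open>Monotonicity asks for measurability of the larger set only.\<close>
  from emeasure_mono[OF this null_setsD2[OF null]] show ?thesis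
    using null_setsD1[OF null] by simp
qed

end

theorem theorem5p2:
  fixes G :: "('a, 'b) monoid_scheme" and T :: "'a topology" and M :: "'a measure"
    and n :: nat and H :: "nat \<Rightarrow> 'a set"
  assumes "profinite_group G T"
    and "top_fin_gen G T (carrier G)"
    and "rank_gradient G T > 0"
    and "\<And>i. i < n \<Longrightarrow> closed_subgroup G T (H i)"
    and "\<And>i. i < n \<Longrightarrow> top_fin_gen G T (H i)"
    and "\<And>i. i < n \<Longrightarrow> infinite (rcosets\<^bsub>G\<^esub> (H i))"
    and "normalized_haar G T M"
  shows "emeasure M (prod_sets G (map H [0..<n])) = 0"
proof -
  interpret group G
    using assms(1) by (simp add: profinite_group_def topological_group_def)
  interpret profinite G T
    by unfold_locales (rule assms(1))
  have "\<forall>A\<in>set (map H [0..<n]). thin A"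
    using assms(4-6) by (auto simp: thin_def)
  from emeasure_covered[OF assms(7) covered_prod_sets[OF assms(3) this]] show ?thesis .
qed

end
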